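(* Let $0<\nu\le 1$, and let $\mathbf z_D$ and $\mathbf z_A$ be the positions of the defender and the intruder. If the intruder continues to move towards the (current) optimal breaching point at its maximum speed $\nu$, then $p(\mathbf z_D,\mathbf z_A,\mathbf z_B)$, evaluated along the play with $\mathbf z_B$ the current optimal breaching point, increases or stays the same, regardless of the defender's behavior.
   Context: Setting. The target is a hemisphere of unit radius centered at the origin $O$ standing on a ground plane; its boundary on the ground is the unit circle (the perimeter). The defender $D$ moves on the hemisphere with first-order dynamics and maximum speed $1$; the intruder $A$ moves on the ground plane outside the unit circle with first-order dynamics and maximum speed $\nu\in(0,1]$. Positions are in spherical coordinates [azimuth, elevation, radius], $\mathbf z_D=[\psi_D,\phi_D,1]$ with $\phi_D\in[0,\pi/2]$ and $\mathbf z_A=[\psi_A,0,r]$, $r>1$; put $\psi=\psi_A-\psi_D$. Measuring azimuth relative to the defender, $\mathbf z_D=[0,\phi_D,1]$ and $\mathbf z_A=[\psi,0,r]$. The intruder moves towards a point of the perimeter along the straight segment; the defender's behavior is any motion on the hemisphere with speed at most $1$. The play is considered until it ends (the intruder reaches the perimeter, or the defender reaches the ground with $\phi_D=\psi=0$). Payoff and optimal breaching point. A breaching point is $\mathbf z_B=[\theta,0,1]$ on the perimeter, with breaching angle $\theta$ (relative to the defender's azimuth). The payoff is $$p(\mathbf z_D,\mathbf z_A,\mathbf z_B)=\cos^{-1}(\cos\phi_D\cos\theta)-\frac1\nu\sqrt{r^2+1-2r\cos(\theta-\psi)},$$ i.e. the defender's geodesic travel time to $\mathbf z_B$ minus the intruder's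 straight-line travel time to $\mathbf z_B$. The approach angle $\beta\in[0,\pi]$ is the angle at $\mathbf z_B$ between $\mathbf z_A-\mathbf z_B$ and the tangent to the unit circle (directed toward decreasing azimuth). The optimal breaching angle $\theta^*$ and optimal approach angle $\beta^*$ for $(\mathbf z_D,\mathbf z_A)$ are those satisfying $$\beta^*=\cos^{-1}\left(\nu\frac{\cos\phi_D\sin\theta^*}{\sqrt{1-\cos^2\phi_D\cos^2\theta^*}}\right),\qquad \theta^*=\psi-\beta^*+\cos^{-1}\left(\frac{\cos\beta^*}{r}\right)$$ (angles modulo $2\pi$), and the optimal breaching point is $\mathbf z_B=[\theta^*,0,1]$. By convention of the paper this pair is unique for given $(\mathbf z_D,\mathbf z_A)$. *)

theory Defs
  imports "HOL-Analysis.Analysis" "HOL-Library.Real_Mod"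
begin

(* Cartesian coordinates of the point [azimuth, elevation, radius]. *)
definition sph_point :: "real \<Rightarrow> real \<Rightarrow> real \<Rightarrow> real^3" where
  "sph_point az el \<rho> =
     vector [\<rho> * cos el * cos az, \<rho> * cos el * sin az, \<rho> * sin el]"

(* The defender is at [0, \<phi>, 1], the intruder at [\<psi>, 0, r] and the breaching point at
   [\<theta>, 0, 1]: all azimuths are relative to that of the defender. *)
definition payoff :: "real \<Rightarrow> real \<Rightarrow> real \<Rightarrow> real \<Rightarrow> real \<Rightarrow> real" where
  "payoff \<nu> \<phi> \<psi> r \<theta> =
     arccos (cos \<phi> * cos \<theta>) - (1 / \<nu>) * sqrt (r^2 + 1 - 2 * r * cos (\<theta> - \<psi>))"

(* \<theta> and \<beta> are an optimal breaching angle (given modulo 2 pi) and the optimal approach angle.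
   The denominator vanishes only for \<phi> = 0 and sin \<theta> = 0, where the quotient is 0 by
   convention and the equations force \<beta> = pi / 2 and \<theta> = \<psi>.  For \<theta> = 0 the play is then over;
   for \<theta> = pi this is the limit of the solution \<theta> = \<psi> = pi that exists for every \<phi> > 0. *)
definition optimal_angles :: "real \<Rightarrow> real \<Rightarrow> real \<Rightarrow> real \<Rightarrow> real \<Rightarrow> real \<Rightarrow> bool" where
  "optimal_angles \<nu> \<phi> \<psi> r \<theta> \<beta> \<longleftrightarrow>
     \<beta> = arccos (\<nu> * (cos \<phi> * sin \<theta> / sqrt (1 - (cos \<phi>)^2 * (cos \<theta>)^2))) \<and>
     [\<theta> = \<psi> - \<beta> + arccos (cos \<beta> / r)] (rmod (2 * pi))"

definition unique_optimal_angles ::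
    "real \<Rightarrow> real \<Rightarrow> real \<Rightarrow> real \<Rightarrow> real \<Rightarrow> real \<Rightarrow> bool" where
  "unique_optimal_angles \<nu> \<phi> \<psi> r \<theta> \<beta> \<longleftrightarrow>
     optimal_angles \<nu> \<phi> \<psi> r \<theta> \<beta> \<and>
     (\<forall>\<theta>' \<beta>'. optimal_angles \<nu> \<phi> \<psi> r \<theta>' \<beta>' \<longrightarrow> [\<theta>' = \<theta>] (rmod (2 * pi)) \<and> \<beta>' = \<beta>)"

end

(* The perimeter points visible from the intruder are parametrized by the approach angle beta in
   [0, pi].  A maximum of the payoff over this arc is stationary, that is, an optimal angle; this also
   holds at the two ends, where the intruder's path is tangent to the circle.  So a unique optimal
   angle is the maximum over the arc; only the kinks of the geodesic distance (defender on the ground, breaching point at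
   the defender or opposite to it) need a separate argument.  Hence the payoff along the play is a
   value function V(t) = max over beta of F(t, beta) with F jointly continuous.  If beta is kept
   fixed at its value at time t, the breaching point is stationary to first order, the intruder
   approaches it at rate nu and the defender, by the spherical triangle inequality, at rate at most
   1.  So the lower right Dini derivative of V is nonnegative. *)
theory Submission
  imports Defs
begin

section \<open>Dini derivatives and spherical distance\<close>

text \<open>Only one-sided information on \<open>V\<close> is assumed, because the optimal approach
  angle is not known to vary continuously in time. The inequality relaxed by slope \<open>e\<close>
  survives at the supremum of \<open>S\<close> by \<open>left\<close>, and \<open>right\<close>
  would carry it beyond that supremum if it were less than \<open>b\<close>.\<close>

lemma le_if_right_dini_nonneg:
  fixes V :: "real \<Rightarrow> real"
  assumes "a \<le> b"
    and right: "\<And>t e. a \<le> t \<Longrightarrow> t < b \<Longrightarrow> 0 < e \<Longrightarrow> \<forall>\<^sub>F s in at_right t. V t - e * (s - t) \<le> V s"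
    and left: "\<And>t e. a < t \<Longrightarrow> t \<le> b \<Longrightarrow> 0 < e \<Longrightarrow> \<forall>\<^sub>F s in at_left t. V s \<le> V t + e"
  shows "V a \<le> V b"
proof -
  have est: "V a - e * (b - a) \<le> V b" if "0 < e" for e
  proof -
    define S where "S = {s \<in> {a..b}. V a - e * (s - a) \<le> V s}"
    define m where "m = Sup S"
    have aS: "a \<in> S" using \<open>a \<le> b\<close> by (simp add: S_def)
    have bdd: "bdd_above S" unfolding S_def by (rule bdd_aboveI[of _ b]) auto
    have am: "a \<le> m" using aS bdd by (simp add: m_def cSup_upper)
    have mb: "m \<le> b" unfolding m_def by (rule cSup_least) (use aS in \<open>auto simp: S_def\<close>)
    have mS: "m \<in> S"
    proof (rule ccontr)
      assume n: "m \<notin> S"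
      then have "a < m" using aS am by (cases "a = m") auto
      have "V a - e * (m - a) \<le> V m + d" if d: "0 < d" for d
      proof -
        obtain c where c: "c < m" "\<And>s. c < s \<Longrightarrow> s < m \<Longrightarrow> V s \<le> V m + d"
          using left[OF \<open>a < m\<close> mb d] \<open>a < m\<close> by (auto simp: eventually_at_left[OF \<open>a < m\<close>])
        obtain s where s: "s \<in> S" "c < s"
          using less_cSup_iff[of S c] aS bdd c(1) m_def by auto
        have "s \<le> m" using s bdd by (simp add: m_def cSup_upper)
        then have "s < m" using n s by (cases "s = m") auto
        then have "V a - e * (s - a) \<le> V m + d" using c(2)[of s] s by (auto simp: S_def)
        moreover have "e * (s - a) \<le> e * (m - a)" using \<open>s < m\<close> \<open>0 < e\<close> by simp
        ultimately show ?thesis by linarith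
      qed
      then have "V a - e * (m - a) \<le> V m" by (rule field_le_epsilon)
      then show False using n am mb by (simp add: S_def)
    qed
    have "m = b"
    proof (rule ccontr)
      assume "m \<noteq> b"
      then have "m < b" using mb by simp
      obtain c where c: "m < c" "\<And>s. m < s \<Longrightarrow> s < c \<Longrightarrow> V m - e * (s - m) \<le> V s"
        using right[OF am \<open>m < b\<close> \<open>0 < e\<close>] by (auto simp: eventually_at_right[OF \<open>m < b\<close>])
      obtain s where s: "m < s" "s < min b c" using dense[of m "min b c"] \<open>m < b\<close> c(1) by auto
      have "V a - e * (s - a) \<le> V s"
        using c(2)[of s] s mS by (simp add: S_def algebra_simps)
      then have "s \<in> S" using s am by (simp add: S_def)
      then have "s \<le> m" using bdd by (simp add: m_def cSup_upper)
      then show False using s by simp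
    qed
    then show ?thesis using mS by (simp add: S_def)
  qed
  show ?thesis
  proof (cases "a = b")
    case False
    then have ab: "0 < b - a" using \<open>a \<le> b\<close> by simp
    show ?thesis
    proof (rule field_le_epsilon)
      fix e :: real assume "0 < e"
      then show "V a \<le> V b + e" using est[of "e / (b - a)"] ab by simp
    qed
  qed simp
qed

text \<open>Cauchy-Schwarz for the components of \<open>u\<close> and \<open>w\<close> orthogonal to
  \<open>v\<close> bounds \<open>u \<bullet> w\<close> from below by the cosine of the sum of the
  two angles. If that sum exceeds \<open>pi\<close>, the range of \<open>arccos\<close>
  suffices.\<close>

lemma arccos_inner_triangle:
  fixes u v w :: "'a :: real_inner"
  assumes "norm u = 1" "norm v = 1" "norm w = 1"
  shows "arccos (u \<bullet> w) \<le> arccos (u \<bullet> v) + arccos (v \<bullet> w)"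
proof -
  have le1: "\<bar>x \<bullet> y\<bar> \<le> 1" if "norm x = 1" "norm y = 1" for x y :: 'a
    using Cauchy_Schwarz_ineq2[of x y] that by simp
  define p where "p = u \<bullet> v"
  define q where "q = v \<bullet> w"
  have pq: "\<bar>p\<bar> \<le> 1" "\<bar>q\<bar> \<le> 1" "\<bar>u \<bullet> w\<bar> \<le> 1"
    using le1 assms by (auto simp: p_def q_def)
  have sq: "u \<bullet> u = 1" "v \<bullet> v = 1" "w \<bullet> w = 1"
    using assms by (simp_all add: dot_square_norm)
  have n1: "norm (u - p *\<^sub>R v) = sqrt (1 - p\<^sup>2)"
    unfolding norm_eq_sqrt_inner using sq
    by (simp add: inner_diff_left inner_diff_right p_def inner_commute power2_eq_square)
  have n2: "norm (w - q *\<^sub>R v) = sqrt (1 - q\<^sup>2)"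
    unfolding norm_eq_sqrt_inner using sq
    by (simp add: inner_diff_left inner_diff_right q_def inner_commute power2_eq_square)
  have "(u - p *\<^sub>R v) \<bullet> (w - q *\<^sub>R v) = u \<bullet> w - p * q"
    using sq by (simp add: inner_diff_left inner_diff_right p_def q_def inner_commute)
  then have "\<bar>u \<bullet> w - p * q\<bar> \<le> sqrt (1 - p\<^sup>2) * sqrt (1 - q\<^sup>2)"
    using Cauchy_Schwarz_ineq2[of "u - p *\<^sub>R v" "w - q *\<^sub>R v"] n1 n2 by simp
  then have low: "cos (arccos p + arccos q) \<le> u \<bullet> w"
    using pq by (simp add: cos_add cos_arccos_abs sin_arccos_abs)
  show ?thesis
  proof (cases "arccos p + arccos q \<le> pi")
    case True
    have "0 \<le> arccos p" "0 \<le> arccos q" using pq by (simp_all add: arccos_lbound abs_le_iff)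
    then have "arccos (u \<bullet> w) \<le> arccos (cos (arccos p + arccos q))"
      using low pq by (intro arccos_le_arccos) auto
    also have "\<dots> = arccos p + arccos q"
      using True \<open>0 \<le> arccos p\<close> \<open>0 \<le> arccos q\<close> by (simp add: arccos_cos)
    finally show ?thesis by (simp add: p_def q_def)
  next
    case False
    have "arccos (u \<bullet> w) \<le> pi" using pq by (simp add: arccos_ubound abs_le_iff)
    then show ?thesis using False by (simp add: p_def q_def)
  qed
qed

text \<open>Turns Euclidean speed bounds into geodesic ones, up to a factor close to 1: half the
  chord is the sine of half the angle, and \<open>arcsin\<close> has derivative 1 at 0.\<close>

lemma arccos_inner_le_dist:
  fixes e :: real
  assumes "0 < e"
  obtains d where "0 < d"
    "\<And>u v :: 'a :: real_inner. norm u = 1 \<Longrightarrow> norm v = 1 \<Longrightarrow> dist u v < d \<Longrightarrow>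
       arccos (u \<bullet> v) \<le> (1 + e) * dist u v"
proof -
  have "(arcsin has_real_derivative 1) (at 0)"
    using DERIV_arcsin[of 0] by simp
  then have "\<exists>d>0. \<forall>h. norm (h - 0) < d \<longrightarrow> norm (arcsin h - arcsin 0 - 1 * (h - 0)) \<le> e * norm (h - 0)"
    using assms unfolding has_field_derivative_def has_derivative_at_alt by blast
  then obtain d where d: "0 < d" "\<And>h. \<bar>h\<bar> < d \<Longrightarrow> \<bar>arcsin h - h\<bar> \<le> e * \<bar>h\<bar>"
    by auto
  have bound: "arccos (u \<bullet> v) \<le> (1 + e) * dist u v"
    if "norm u = 1" "norm v = 1" "dist u v < min 1 d" for u v :: 'a
  proof -
    define c where "c = dist u v / 2"
    have c: "0 \<le> c" "c \<le> 1/2" "\<bar>c\<bar> < d" using that d(1) by (auto simp: c_def)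
    have uv: "u \<bullet> v = 1 - 2 * c\<^sup>2"
      using that by (simp add: c_def dist_norm dot_norm_neg power_divide diff_divide_distrib)
    have "cos (2 * arcsin c) = u \<bullet> v"
      using c uv by (simp add: cos_double_sin)
    moreover have "0 \<le> arcsin c" "arcsin c \<le> pi / 2"
      using c arcsin_le_arcsin[of 0 c] arcsin_ubound[of c] by auto
    ultimately have "arccos (u \<bullet> v) = 2 * arcsin c"
      using arccos_cos[of "2 * arcsin c"] by simp
    also have "\<dots> \<le> 2 * ((1 + e) * c)" using d(2)[OF c(3)] c by (simp add: algebra_simps)
    finally show ?thesis by (simp add: c_def)
  qed
  show ?thesis by (rule that[of "min 1 d"]) (use bound d(1) in auto)
qed

section \<open>The optimal breaching angle\<close>

text \<open>The second optimality equation read as a parametrization: for \<open>\<beta>\<close>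
  from 0 to \<open>pi\<close> it sweeps the visible arc from the tangent point at
  \<open>\<psi> + arccos (1 / r)\<close> to the one at
  \<open>\<psi> - arccos (1 / r)\<close>.\<close>

definition breach_angle :: "real \<Rightarrow> real \<Rightarrow> real \<Rightarrow> real" where
  "breach_angle r \<psi> \<beta> = \<psi> - \<beta> + arccos (cos \<beta> / r)"

definition approach_length :: "real \<Rightarrow> real \<Rightarrow> real" where
  "approach_length r \<beta> = sqrt (r\<^sup>2 - (cos \<beta>)\<^sup>2) - sin \<beta>"

text \<open>Here \<open>sqrt (r\<^sup>2 - (cos \<beta>)\<^sup>2)\<close> is the distance from the intruder to the foot of the
  perpendicular dropped from the origin on its path, and \<open>sin \<beta>\<close> that from the breaching point.\<close>

definition breach_payoff :: "real \<Rightarrow> real \<Rightarrow> real \<Rightarrow> real \<Rightarrow> real \<Rightarrow> real" where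
  "breach_payoff \<nu> \<phi> \<psi> r \<beta> =
     arccos (cos \<phi> * cos (breach_angle r \<psi> \<beta>)) - approach_length r \<beta> / \<nu>"

section \<open>Geometry of the visible arc\<close>

lemma abs_cos_div_less_1:
  fixes r \<beta> :: real
  assumes "1 < r"
  shows "\<bar>cos \<beta> / r\<bar> < 1"
  using assms abs_cos_le_one[of \<beta>] by (simp add: abs_mult divide_simps del: abs_cos_le_one)

lemma square_minus_cos_square_pos:
  fixes r \<beta> :: real
  assumes "1 < r"
  shows "(sin \<beta>)\<^sup>2 < r\<^sup>2 - (cos \<beta>)\<^sup>2" "0 < r\<^sup>2 - (cos \<beta>)\<^sup>2"
proof -
  have "1 < r\<^sup>2" using assms by (simp add: one_less_power)
  then show "(sin \<beta>)\<^sup>2 < r\<^sup>2 - (cos \<beta>)\<^sup>2" using sin_cos_squared_add[of \<beta>] by linarith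
  then show "0 < r\<^sup>2 - (cos \<beta>)\<^sup>2" using zero_le_power2[of "sin \<beta>"] by linarith
qed

lemma sin_less_sqrt:
  fixes r \<beta> :: real
  assumes "1 < r"
  shows "sin \<beta> < sqrt (r\<^sup>2 - (cos \<beta>)\<^sup>2)"
proof -
  have "\<bar>sin \<beta>\<bar> < sqrt (r\<^sup>2 - (cos \<beta>)\<^sup>2)"
    using square_minus_cos_square_pos(1)[OF assms] real_less_rsqrt[of "\<bar>sin \<beta>\<bar>"] by simp
  then show ?thesis by simp
qed

lemma sin_arccos_cos_div:
  fixes r \<beta> :: real
  assumes "1 < r"
  shows "sin (arccos (cos \<beta> / r)) = sqrt (r\<^sup>2 - (cos \<beta>)\<^sup>2) / r"
proof -
  have "1 - (cos \<beta> / r)\<^sup>2 = (r\<^sup>2 - (cos \<beta>)\<^sup>2) / r\<^sup>2"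
    using assms by (simp add: field_simps)
  then show ?thesis
    using assms abs_cos_div_less_1[OF assms, of \<beta>] by (simp add: sin_arccos_abs real_sqrt_divide)
qed

lemma cos_arccos_cos_div:
  fixes r \<beta> :: real
  assumes "1 < r"
  shows "cos (arccos (cos \<beta> / r)) = cos \<beta> / r"
  using abs_cos_div_less_1[OF assms, of \<beta>] by (simp add: cos_arccos_abs)

lemma cos_sin_rcong:
  assumes "[x = y] (rmod 2 * pi)"
  shows "cos x = cos y" "sin x = sin y"
proof -
  obtain n :: int where "y = x + of_int n * (2 * pi)" using assms by (auto simp: rcong_altdef)
  then have "y = x + 2 * pi * of_int n" by simp
  then show "cos x = cos y" "sin x = sin y"
    by (simp_all add: cos_add sin_add)
qed

text \<open>On the arc the law of cosines gives a perfect square under the root,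
  \<open>(w - sin \<beta>)\<^sup>2\<close>, and \<open>sin \<beta> < w\<close> decides the sign of
  its root.\<close>

lemma payoff_eq_breach_payoff:
  assumes "1 < r" "[\<theta> = breach_angle r \<psi> \<beta>] (rmod 2 * pi)"
  shows "payoff \<nu> \<phi> \<psi> r \<theta> = breach_payoff \<nu> \<phi> \<psi> r \<beta>"
proof -
  define w where "w = sqrt (r\<^sup>2 - (cos \<beta>)\<^sup>2)"
  have w: "w\<^sup>2 = r\<^sup>2 - (cos \<beta>)\<^sup>2" "sin \<beta> < w"
    using square_minus_cos_square_pos(2)[OF assms(1), of \<beta>] sin_less_sqrt[OF assms(1), of \<beta>]
    by (auto simp: w_def)
  have "[\<theta> - \<psi> = breach_angle r \<psi> \<beta> - \<psi>] (rmod 2 * pi)" using assms(2) by simp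
  then have "r * cos (\<theta> - \<psi>) = r * cos (arccos (cos \<beta> / r) - \<beta>)"
    by (simp add: cos_sin_rcong(1) breach_angle_def)
  also have "\<dots> = (cos \<beta>)\<^sup>2 + w * sin \<beta>"
    unfolding cos_diff using assms(1)
    by (simp add: sin_arccos_cos_div cos_arccos_cos_div w_def power2_eq_square field_simps)
  finally have "r\<^sup>2 + 1 - 2 * r * cos (\<theta> - \<psi>) = (w - sin \<beta>)\<^sup>2"
    using w(1) sin_cos_squared_add[of \<beta>] unfolding power2_diff mult.assoc by linarith
  then have "sqrt (r\<^sup>2 + 1 - 2 * r * cos (\<theta> - \<psi>)) = approach_length r \<beta>"
    using w(2) by (simp add: approach_length_def w_def)
  then show ?thesis
    using cos_sin_rcong(1)[OF assms(2)] by (simp add: payoff_def breach_payoff_def)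
qed

lemma breach_angle_has_derivative:
  assumes "1 < r"
  shows "(breach_angle r \<psi> has_real_derivative sin \<beta> / sqrt (r\<^sup>2 - (cos \<beta>)\<^sup>2) - 1) (at \<beta>)"
proof -
  have b: "- 1 < cos \<beta> / r" "cos \<beta> / r < 1"
    using abs_cos_div_less_1[OF assms, of \<beta>] by (simp_all only: abs_less_iff) linarith
  have q: "sqrt (1 - (cos \<beta> / r)\<^sup>2) = sqrt (r\<^sup>2 - (cos \<beta>)\<^sup>2) / r"
    using sin_arccos_cos_div[OF assms, of \<beta>] b by (simp add: sin_arccos)
  have "0 < sqrt (r\<^sup>2 - (cos \<beta>)\<^sup>2)" using square_minus_cos_square_pos(2)[OF assms] by simp
  then have "inverse (- sqrt (1 - (cos \<beta> / r)\<^sup>2)) * (- sin \<beta> / r) = sin \<beta> / sqrt (r\<^sup>2 - (cos \<beta>)\<^sup>2)"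
    unfolding q using assms by (simp add: field_simps)
  moreover have "((\<lambda>x. \<psi> - x + arccos (cos x / r)) has_real_derivative
      0 - 1 + inverse (- sqrt (1 - (cos \<beta> / r)\<^sup>2)) * (- sin \<beta> / r)) (at \<beta>)"
    by (intro derivative_intros DERIV_chain2[OF DERIV_arccos] b DERIV_cdivide DERIV_cos)
  ultimately show ?thesis unfolding breach_angle_def[abs_def] by (simp add: algebra_simps)
qed

lemma breach_angle_derivative_neg:
  fixes r \<beta> :: real
  assumes "1 < r"
  shows "sin \<beta> / sqrt (r\<^sup>2 - (cos \<beta>)\<^sup>2) - 1 < 0"
  using sin_less_sqrt[OF assms, of \<beta>] square_minus_cos_square_pos(2)[OF assms, of \<beta>] by simp

text \<open>The derivative is \<open>cos \<beta>\<close> times that of \<open>breach_angle\<close>.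
  So the derivative of a payoff \<open>K - approach_length / \<nu>\<close> along the arc has a
  common negative factor, and its sign is that of \<open>cos \<beta> - \<nu> * Q\<close>, where
  \<open>Q\<close> is the slope of \<open>K\<close>.\<close>

lemma approach_length_has_derivative:
  assumes "1 < r"
  shows "(approach_length r has_real_derivative
    cos \<beta> * (sin \<beta> / sqrt (r\<^sup>2 - (cos \<beta>)\<^sup>2) - 1)) (at \<beta>)"
  unfolding approach_length_def[abs_def]
  using square_minus_cos_square_pos(2)[OF assms, of \<beta>]
  by (auto intro!: derivative_eq_intros simp: field_simps)

lemma breach_angle_strict_antimono:
  assumes "1 < r" "a < b"
  shows "breach_angle r \<psi> b < breach_angle r \<psi> a"
  by (rule DERIV_neg_imp_decreasing[OF assms(2)])
    (use breach_angle_has_derivative[OF assms(1)] breach_angle_derivative_neg[OF assms(1)] in blast)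

lemma breach_angle_antimono:
  assumes "1 < r" "a \<le> b"
  shows "breach_angle r \<psi> b \<le> breach_angle r \<psi> a"
  using breach_angle_strict_antimono[OF assms(1), of a b \<psi>] assms(2) by (cases "a = b") auto

text \<open>The visible arc has length \<open>2 * arccos (1 / r)\<close>, less than a half circle.
  The formulas for the distance near a kink are therefore valid on the whole arc.\<close>

lemma breach_angle_diff_less_pi:
  assumes "1 < r" "a \<in> {0..pi}" "b \<in> {0..pi}"
  shows "\<bar>breach_angle r \<psi> a - breach_angle r \<psi> b\<bar> < pi"
proof -
  have "breach_angle r \<psi> 0 = \<psi> + arccos (1 / r)"
    "breach_angle r \<psi> pi = \<psi> - arccos (1 / r)"
    using assms(1) arccos_minus[of "1 / r"] by (auto simp: breach_angle_def divide_simps)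
  moreover have "arccos (1 / r) < arccos 0"
    using assms(1) by (intro arccos_less_arccos) auto
  moreover have "breach_angle r \<psi> x \<le> breach_angle r \<psi> 0" "breach_angle r \<psi> pi \<le> breach_angle r \<psi> x"
    if "x \<in> {0..pi}" for x using that by (auto intro: breach_angle_antimono[OF assms(1)])
  ultimately show ?thesis using assms(2,3) by (smt (verit) arccos_0 field_sum_of_halves)
qed

section \<open>First-order conditions for a maximum over the arc\<close>

text \<open>\<open>K\<close> stands for the defender's distance as a function of the breaching
  angle, or for a linear function touching it at a kink. The one-sided form serves the ends of the
  arc and the antipodal kink, where the slopes on the two sides differ.\<close>

lemma cos_le_if_right_max:
  assumes "1 < r" "0 < \<nu>" "\<beta> < pi"
    and K: "(K has_real_derivative Q) (at (breach_angle r \<psi> \<beta>))"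
    and max: "\<And>b. \<beta> \<le> b \<Longrightarrow> b \<le> pi \<Longrightarrow>
      K (breach_angle r \<psi> b) - approach_length r b / \<nu>
        \<le> K (breach_angle r \<psi> \<beta>) - approach_length r \<beta> / \<nu>"
  shows "cos \<beta> \<le> \<nu> * Q"
proof (rule ccontr)
  assume "\<not> cos \<beta> \<le> \<nu> * Q"
  define D where "D = sin \<beta> / sqrt (r\<^sup>2 - (cos \<beta>)\<^sup>2) - 1"
  have "((\<lambda>b. K (breach_angle r \<psi> b) - approach_length r b / \<nu>) has_real_derivative
      Q * D - cos \<beta> * D / \<nu>) (at \<beta>)"
    using K breach_angle_has_derivative[OF assms(1), of \<psi> \<beta>] approach_length_has_derivative[OF assms(1), of \<beta>]
    unfolding D_def by (intro DERIV_diff DERIV_cdivide DERIV_chain2[of K])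
  moreover have "0 < Q * D - cos \<beta> * D / \<nu>"
  proof -
    have "D < 0" unfolding D_def by (rule breach_angle_derivative_neg[OF assms(1)])
    then have "0 < (\<nu> * Q - cos \<beta>) * D / \<nu>"
      using \<open>\<not> cos \<beta> \<le> \<nu> * Q\<close> assms(2) by (intro divide_pos_pos mult_neg_neg) auto
    also have "\<dots> = Q * D - cos \<beta> * D / \<nu>" using assms(2) by (simp add: field_simps)
    finally show ?thesis .
  qed
  ultimately obtain d where d: "0 < d" "\<And>h. 0 < h \<Longrightarrow> h < d \<Longrightarrow>
      K (breach_angle r \<psi> \<beta>) - approach_length r \<beta> / \<nu>
        < K (breach_angle r \<psi> (\<beta> + h)) - approach_length r (\<beta> + h) / \<nu>"
    using DERIV_pos_inc_right by blast
  obtain h where "0 < h" "h < min d (pi - \<beta>)" using dense[of 0 "min d (pi - \<beta>)"] d(1) assms(3) by auto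
  then show False using d(2)[of h] max[of "\<beta> + h"] by simp
qed

lemma cos_ge_if_left_max:
  assumes "1 < r" "0 < \<nu>" "0 < \<beta>"
    and K: "(K has_real_derivative Q) (at (breach_angle r \<psi> \<beta>))"
    and max: "\<And>b. 0 \<le> b \<Longrightarrow> b \<le> \<beta> \<Longrightarrow>
      K (breach_angle r \<psi> b) - approach_length r b / \<nu>
        \<le> K (breach_angle r \<psi> \<beta>) - approach_length r \<beta> / \<nu>"
  shows "\<nu> * Q \<le> cos \<beta>"
proof (rule ccontr)
  assume "\<not> \<nu> * Q \<le> cos \<beta>"
  define D where "D = sin \<beta> / sqrt (r\<^sup>2 - (cos \<beta>)\<^sup>2) - 1"
  have "((\<lambda>b. K (breach_angle r \<psi> b) - approach_length r b / \<nu>) has_real_derivative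
      Q * D - cos \<beta> * D / \<nu>) (at \<beta>)"
    using K breach_angle_has_derivative[OF assms(1), of \<psi> \<beta>] approach_length_has_derivative[OF assms(1), of \<beta>]
    unfolding D_def by (intro DERIV_diff DERIV_cdivide DERIV_chain2[of K])
  moreover have "Q * D - cos \<beta> * D / \<nu> < 0"
  proof -
    have "D < 0" unfolding D_def by (rule breach_angle_derivative_neg[OF assms(1)])
    then have "(\<nu> * Q - cos \<beta>) * D / \<nu> < 0"
      using \<open>\<not> \<nu> * Q \<le> cos \<beta>\<close> assms(2) by (intro divide_neg_pos mult_pos_neg) auto
    moreover have "(\<nu> * Q - cos \<beta>) * D / \<nu> = Q * D - cos \<beta> * D / \<nu>"
      using assms(2) by (simp add: field_simps)
    ultimately show ?thesis by simp
  qed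
  ultimately obtain d where d: "0 < d" "\<And>h. 0 < h \<Longrightarrow> h < d \<Longrightarrow>
      K (breach_angle r \<psi> \<beta>) - approach_length r \<beta> / \<nu>
        < K (breach_angle r \<psi> (\<beta> - h)) - approach_length r (\<beta> - h) / \<nu>"
    using DERIV_neg_dec_left by blast
  obtain h where "0 < h" "h < min d \<beta>" using dense[of 0 "min d \<beta>"] d(1) assms(3) by auto
  then show False using d(2)[of h] max[of "\<beta> - h"] by simp
qed

text \<open>At the ends of the arc the one-sided condition already forces equality, because
  \<open>\<bar>\<nu> * Q\<bar> \<le> 1\<close>.\<close>

lemma cos_eq_if_max:
  assumes "1 < r" "0 < \<nu>" "\<nu> \<le> 1" "\<beta> \<in> {0..pi}" "\<bar>Q\<bar> \<le> 1"
    and K: "(K has_real_derivative Q) (at (breach_angle r \<psi> \<beta>))"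
    and max: "\<And>b. b \<in> {0..pi} \<Longrightarrow>
      K (breach_angle r \<psi> b) - approach_length r b / \<nu>
        \<le> K (breach_angle r \<psi> \<beta>) - approach_length r \<beta> / \<nu>"
  shows "cos \<beta> = \<nu> * Q"
proof -
  have "\<bar>\<nu> * Q\<bar> \<le> 1" using assms(2,3,5) by (simp add: abs_mult mult_le_one)
  then have Q: "\<nu> * Q \<le> 1" "- 1 \<le> \<nu> * Q" by (simp_all add: abs_le_iff)
  have "cos \<beta> \<le> \<nu> * Q"
  proof (cases "\<beta> = pi")
    case False
    then show ?thesis using assms by (intro cos_le_if_right_max[OF assms(1,2) _ K]) auto
  qed (use Q in simp)
  moreover have "\<nu> * Q \<le> cos \<beta>"
  proof (cases "\<beta> = 0")
    case False
    then show ?thesis using assms by (intro cos_ge_if_left_max[OF assms(1,2) _ K]) auto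
  qed (use Q in simp)
  ultimately show ?thesis by simp
qed

section \<open>The first optimality equation as stationarity\<close>

text \<open>Away from the kinks this is the derivative in \<open>\<theta>\<close> of the defender's
  geodesic distance to the breaching point; at the kinks division by zero makes it 0.\<close>

definition lateral_ratio :: "real \<Rightarrow> real \<Rightarrow> real" where
  "lateral_ratio \<phi> \<theta> = cos \<phi> * sin \<theta> / sqrt (1 - (cos \<phi>)\<^sup>2 * (cos \<theta>)\<^sup>2)"

lemma abs_lateral_ratio_le_1: "\<bar>lateral_ratio \<phi> \<theta>\<bar> \<le> 1"
proof -
  have "(cos \<phi>)\<^sup>2 * (sin \<theta>)\<^sup>2 + (cos \<phi>)\<^sup>2 * (cos \<theta>)\<^sup>2 = (cos \<phi>)\<^sup>2"
    by (simp flip: distrib_left)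
  then have "(cos \<phi> * sin \<theta>)\<^sup>2 \<le> 1 - (cos \<phi>)\<^sup>2 * (cos \<theta>)\<^sup>2"
    using abs_square_le_1[of "cos \<phi>"] by (simp add: power_mult_distrib)
  then have "\<bar>cos \<phi> * sin \<theta>\<bar> \<le> sqrt (1 - (cos \<phi>)\<^sup>2 * (cos \<theta>)\<^sup>2)"
    by (metis real_sqrt_abs real_sqrt_le_iff)
  moreover have "\<bar>a / d\<bar> \<le> 1" if "\<bar>a\<bar> \<le> d" for a d :: real
    using that by (cases "d = 0") (auto simp: abs_divide)
  ultimately show ?thesis unfolding lateral_ratio_def by blast
qed

text \<open>The argument of \<open>arccos\<close> lies in [-1, 1], so the equation for
  \<open>\<beta>\<close> can be inverted; it becomes the first-order condition of
  \<open>cos_eq_if_max\<close>.\<close>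

lemma optimal_angles_iff:
  assumes "0 < \<nu>" "\<nu> \<le> 1"
  shows "optimal_angles \<nu> \<phi> \<psi> r \<theta> \<beta> \<longleftrightarrow>
    \<beta> \<in> {0..pi} \<and> cos \<beta> = \<nu> * lateral_ratio \<phi> \<theta> \<and>
    [\<theta> = breach_angle r \<psi> \<beta>] (rmod 2 * pi)"
proof -
  have "\<bar>\<nu> * lateral_ratio \<phi> \<theta>\<bar> \<le> 1"
    using assms abs_lateral_ratio_le_1[of \<phi> \<theta>] by (simp add: abs_mult mult_le_one)
  then have "\<beta> = arccos (\<nu> * lateral_ratio \<phi> \<theta>) \<longleftrightarrow>
      \<beta> \<in> {0..pi} \<and> cos \<beta> = \<nu> * lateral_ratio \<phi> \<theta>"
    by (auto simp: cos_arccos_abs arccos_cos abs_le_iff arccos_lbound arccos_ubound)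
      (metis arccos_cos)+
  then show ?thesis
    by (simp add: optimal_angles_def lateral_ratio_def breach_angle_def)
qed

lemma lateral_ratio_rcong:
  assumes "[x = y] (rmod 2 * pi)"
  shows "lateral_ratio \<phi> x = lateral_ratio \<phi> y"
  by (simp add: lateral_ratio_def cos_sin_rcong[OF assms])

lemma arccos_cos_cos_has_derivative:
  assumes "(cos \<phi>)\<^sup>2 * (cos x)\<^sup>2 \<noteq> 1"
  shows "((\<lambda>x. arccos (cos \<phi> * cos x)) has_real_derivative lateral_ratio \<phi> x) (at x)"
proof -
  have "\<bar>cos \<phi> * cos x\<bar> \<le> 1" by (simp add: abs_mult mult_le_one)
  moreover have "\<bar>cos \<phi> * cos x\<bar> \<noteq> 1"
    using assms by (metis abs_square_eq_1 power_mult_distrib)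
  ultimately have b: "- 1 < cos \<phi> * cos x" "cos \<phi> * cos x < 1" by (auto simp: abs_less_iff)
  show ?thesis
    using b by (auto intro!: derivative_eq_intros DERIV_chain2[OF DERIV_arccos]
        simp: lateral_ratio_def power_mult_distrib divide_inverse)
qed

section \<open>Kinks of the distance for a defender on the ground\<close>

lemma arccos_cos_near_min:
  fixes x y :: real
  assumes "cos y = 1" "\<bar>x - y\<bar> < pi"
  shows "arccos (cos x) = \<bar>x - y\<bar>"
proof -
  have "sin y = 0" using assms(1) sin_cos_squared_add[of y] by simp
  then have "cos x = cos (x - y)" using assms(1) by (simp add: cos_diff)
  then show ?thesis using assms(2) by (simp add: arccos_cos_eq_abs)
qed

lemma arccos_cos_near_max:
  fixes x y :: real
  assumes "cos y = - 1" "\<bar>x - y\<bar> < pi"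
  shows "arccos (cos x) = pi - \<bar>x - y\<bar>"
proof -
  have "sin y = 0" using assms(1) sin_cos_squared_add[of y] by simp
  then have "cos x = - cos (x - y)" using assms(1) by (simp add: cos_diff)
  then show ?thesis using assms(2) by (simp add: arccos_minus_abs arccos_cos_eq_abs)
qed

lemma max_breach_payoff_not_at_defender:
  assumes "1 < r" "0 < \<nu>" "\<nu> \<le> 1" "\<beta> \<in> {0..pi}" "cos (breach_angle r \<psi> \<beta>) = 1"
    and max: "\<And>b. b \<in> {0..pi} \<Longrightarrow> breach_payoff \<nu> 0 \<psi> r b \<le> breach_payoff \<nu> 0 \<psi> r \<beta>"
  shows False
proof -
  let ?y = "breach_angle r \<psi> \<beta>"
  \<comment> \<open>Both linear minorants of the kink at \<open>?y\<close> would have to be critical.\<close>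
  have crit: "cos \<beta> = \<nu> * k" if "\<bar>k\<bar> = 1" for k :: real
  proof (rule cos_eq_if_max[OF assms(1-4)])
    show "((\<lambda>x. k * (x - ?y)) has_real_derivative k) (at ?y)"
      by (auto intro!: derivative_eq_intros)
    fix b assume b: "b \<in> {0..pi}"
    have "k * (breach_angle r \<psi> b - ?y) \<le> \<bar>breach_angle r \<psi> b - ?y\<bar>"
      using that abs_ge_self[of "k * (breach_angle r \<psi> b - ?y)"] by (simp add: abs_mult)
    also have "\<dots> = arccos (cos (breach_angle r \<psi> b))"
      using assms b by (simp add: arccos_cos_near_min breach_angle_diff_less_pi)
    finally show "k * (breach_angle r \<psi> b - ?y) - approach_length r b / \<nu>
        \<le> k * (?y - ?y) - approach_length r \<beta> / \<nu>"
      using max[OF b] assms(5) by (simp add: breach_payoff_def)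
  qed (use that in simp)
  show False using crit[of 1] crit[of "- 1"] assms(2) by simp
qed

text \<open>The kink is concave here: the distance is \<open>pi\<close> minus the angular deviation,
  with slope 1 below \<open>?y\<close> and -1 above it. Each side yields one inequality, so the
  maximum need not be stationary.\<close>

lemma max_breach_payoff_at_antipode:
  assumes "1 < r" "0 < \<nu>" "\<nu> \<le> 1" "\<beta> \<in> {0..pi}" "cos (breach_angle r \<psi> \<beta>) = - 1"
    and max: "\<And>b. b \<in> {0..pi} \<Longrightarrow> breach_payoff \<nu> 0 \<psi> r b \<le> breach_payoff \<nu> 0 \<psi> r \<beta>"
  shows "\<bar>cos \<beta>\<bar> \<le> \<nu>"
proof -
  let ?y = "breach_angle r \<psi> \<beta>"
  have eq: "breach_payoff \<nu> 0 \<psi> r b = pi - \<bar>breach_angle r \<psi> b - ?y\<bar> - approach_length r b / \<nu>"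
    if "b \<in> {0..pi}" for b
    using assms that by (simp add: breach_payoff_def arccos_cos_near_max breach_angle_diff_less_pi)
  have "cos \<beta> \<le> \<nu> * 1"
  proof (cases "\<beta> = pi")
    case False
    show ?thesis
    proof (rule cos_le_if_right_max[OF assms(1,2)])
      \<comment> \<open>Larger approach angles give smaller breaching angles, so to the right of
        \<open>\<beta>\<close> the absolute value resolves to \<open>?y - x\<close>.\<close>
      show "((\<lambda>x. x - ?y) has_real_derivative 1) (at ?y)" by (auto intro!: derivative_eq_intros)
      fix b assume b: "\<beta> \<le> b" "b \<le> pi"
      then show "breach_angle r \<psi> b - ?y - approach_length r b / \<nu>
          \<le> ?y - ?y - approach_length r \<beta> / \<nu>"
        using max[of b] eq[of b] eq[of \<beta>] breach_angle_antimono[OF assms(1) b(1), of \<psi>] assms(4)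
        by simp
    qed (use False assms(4) in simp)
  qed (use assms(2) in simp)
  moreover have "\<nu> * (- 1) \<le> cos \<beta>"
  proof (cases "\<beta> = 0")
    case False
    show ?thesis
    proof (rule cos_ge_if_left_max[OF assms(1,2)])
      show "((\<lambda>x. ?y - x) has_real_derivative - 1) (at ?y)" by (auto intro!: derivative_eq_intros)
      fix b assume b: "0 \<le> b" "b \<le> \<beta>"
      then show "?y - breach_angle r \<psi> b - approach_length r b / \<nu>
          \<le> ?y - ?y - approach_length r \<beta> / \<nu>"
        using max[of b] eq[of b] eq[of \<beta>] breach_angle_antimono[OF assms(1) b(2), of \<psi>] assms(4)
        by simp
    qed (use False assms(4) in simp)
  qed (use assms(2) in simp)
  ultimately show ?thesis by (simp add: abs_le_iff)
qed

text \<open>The opposite point can be a maximum that is not stationary.  In that case there is no optimal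
  angle at all, unless it is the one obtained from the convention \<open>0 / 0 = 0\<close>.\<close>

lemma optimal_angle_at_antipode:
  assumes "1 < r" "0 < \<nu>" "\<nu> \<le> 1" "\<gamma> \<in> {0..pi}" "cos (breach_angle r \<psi> \<gamma>) = - 1" "\<bar>cos \<gamma>\<bar> \<le> \<nu>"
    and "\<not> [\<psi> = 0] (rmod 2 * pi)"
    and opt: "optimal_angles \<nu> 0 \<psi> r \<theta> \<beta>"
  shows "\<beta> = \<gamma>"
proof -
  define x where "x = breach_angle r \<psi> \<beta>"
  define y where "y = breach_angle r \<psi> \<gamma>"
  have \<beta>: "\<beta> \<in> {0..pi}" "cos \<beta> = \<nu> * lateral_ratio 0 x"
    using opt assms(2,3) by (auto simp: optimal_angles_iff x_def lateral_ratio_rcong)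
  have near: "\<bar>x - y\<bar> < pi"
    using assms \<beta>(1) by (simp add: x_def y_def breach_angle_diff_less_pi)
  have "sin y = 0" using assms(5) sin_cos_squared_add[of y] by (simp add: y_def)
  then have xy: "sin x = - sin (x - y)" "cos x = - cos (x - y)"
    using assms(5) by (simp_all add: sin_diff cos_diff y_def)
  have ratio: "lateral_ratio 0 x = sgn (sin x)"
  proof -
    have "1 - (cos x)\<^sup>2 = (sin x)\<^sup>2" using sin_cos_squared_add[of x] by linarith
    then show ?thesis by (simp add: lateral_ratio_def sgn_real_def)
  qed
  \<comment> \<open>A positive sine would give \<open>cos \<beta> = \<nu>\<close>, hence
    \<open>\<beta> \<le> \<gamma>\<close> and \<open>y \<le> x\<close>. But \<open>y\<close> is an
    odd multiple of \<open>pi\<close>, and the sine is nonpositive on the half circle following it.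
    The other sign is symmetric.\<close>
  have "sin x \<le> 0"
  proof (rule ccontr)
    assume "\<not> sin x \<le> 0"
    then have "cos \<gamma> \<le> cos \<beta>" using assms(6) \<beta>(2) ratio by simp
    then have "\<beta> \<le> \<gamma>" using assms(4) \<beta>(1) by (simp add: cos_mono_le_eq)
    then have "0 \<le> x - y" by (simp add: x_def y_def breach_angle_antimono[OF assms(1)])
    then have "0 \<le> sin (x - y)" using near by (simp add: sin_ge_zero)
    then show False using xy \<open>\<not> sin x \<le> 0\<close> by simp
  qed
  moreover have "0 \<le> sin x"
  proof (rule ccontr)
    assume "\<not> 0 \<le> sin x"
    then have "cos \<beta> \<le> cos \<gamma>" using assms(6) \<beta>(2) ratio by simp
    then have "\<gamma> \<le> \<beta>" using assms(4) \<beta>(1) by (simp add: cos_mono_le_eq)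
    then have "0 \<le> y - x" by (simp add: x_def y_def breach_angle_antimono[OF assms(1)])
    then have "0 \<le> sin (y - x)" using near by (simp add: sin_ge_zero)
    then show False using xy \<open>\<not> 0 \<le> sin x\<close> sin_minus[of "x - y"] by simp
  qed
  \<comment> \<open>Now \<open>lateral_ratio\<close> is 0 by the division convention. Both
    \<open>x\<close> and \<open>y\<close> are multiples of \<open>pi\<close>, and
    \<open>near\<close> leaves only \<open>x = y\<close>.\<close>
  ultimately have s: "sin x = 0" by simp
  then have "cos \<beta> = cos (pi / 2)" using \<beta>(2) ratio by simp
  then have "\<beta> = pi / 2" using \<beta>(1) cos_inj_pi[of \<beta> "pi / 2"] by simp
  then have "x = \<psi>" unfolding x_def breach_angle_def by (simp only:) simp
  have "cos x \<noteq> 1"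
  proof
    assume "cos x = 1"
    then obtain n :: int where "\<psi> = of_int n * (2 * pi)"
      using \<open>x = \<psi>\<close> by (auto simp: cos_one_2pi_int)
    then have "[\<psi> = 0] (rmod 2 * pi)"
      unfolding rcong_altdef by (intro exI[of _ "- n"]) simp
    then show False using assms(7) by simp
  qed
  moreover have "sin (x - y) = 0" using s xy by simp
  then have "x = y"
    using near sin_zero_pi_iff[of "x - y"] by simp
  then show ?thesis
    using breach_angle_strict_antimono[OF assms(1), of \<beta> \<gamma> \<psi>]
      breach_angle_strict_antimono[OF assms(1), of \<gamma> \<beta> \<psi>]
    by (cases \<beta> \<gamma> rule: linorder_cases) (auto simp: x_def y_def)
qed

text \<open>No second-order condition is examined at \<open>\<beta>\<close>. A maximum
  \<open>\<gamma>\<close> exists by compactness; off the kinks it is itself optimal, so uniqueness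
  gives \<open>\<beta> = \<gamma>\<close>, and at the antipodal kink
  \<open>optimal_angle_at_antipode\<close> gives it.\<close>

lemma unique_optimal_angle_is_max:
  assumes "1 < r" "0 < \<nu>" "\<nu> \<le> 1" "0 \<le> \<phi>" "\<phi> \<le> pi / 2"
    and not_captured: "\<not> (\<phi> = 0 \<and> [\<psi> = 0] (rmod 2 * pi))"
    and opt: "unique_optimal_angles \<nu> \<phi> \<psi> r \<theta> \<beta>"
    and b: "b \<in> {0..pi}"
  shows "breach_payoff \<nu> \<phi> \<psi> r b \<le> breach_payoff \<nu> \<phi> \<psi> r \<beta>"
proof -
  have "continuous_on {0..pi} (breach_payoff \<nu> \<phi> \<psi> r)"
  proof -
    have "continuous_on {0..pi} (breach_angle r \<psi>)" "continuous_on {0..pi} (approach_length r)"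
      using breach_angle_has_derivative[OF assms(1)] approach_length_has_derivative[OF assms(1)]
      by (blast intro: continuous_at_imp_continuous_on DERIV_isCont)+
    moreover have "- 1 \<le> cos \<phi> * cos x \<and> cos \<phi> * cos x \<le> 1" for x
    proof -
      have "\<bar>cos \<phi> * cos x\<bar> \<le> 1" by (simp add: abs_mult mult_le_one)
      then show ?thesis by linarith
    qed
    ultimately show ?thesis
      using assms(2) unfolding breach_payoff_def[abs_def]
      by (intro continuous_intros) auto
  qed
  then obtain \<gamma> where \<gamma>: "\<gamma> \<in> {0..pi}"
    and max: "\<And>b. b \<in> {0..pi} \<Longrightarrow> breach_payoff \<nu> \<phi> \<psi> r b \<le> breach_payoff \<nu> \<phi> \<psi> r \<gamma>"
    using continuous_attains_sup[of "{0..pi}" "breach_payoff \<nu> \<phi> \<psi> r"] by fastforce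
  let ?y = "breach_angle r \<psi> \<gamma>"
  have "\<beta> = \<gamma>"
  \<comment> \<open>Equality singles out the kinks: both squares must be 1, which puts the defender
    on the ground and the breaching point at the defender or opposite to it.\<close>
  proof (cases "(cos \<phi>)\<^sup>2 * (cos ?y)\<^sup>2 = 1")
    case False
    have "cos \<gamma> = \<nu> * lateral_ratio \<phi> ?y"
      using max unfolding breach_payoff_def
      by (intro cos_eq_if_max[OF assms(1-3) \<gamma> abs_lateral_ratio_le_1 arccos_cos_cos_has_derivative[OF False]])
    then have "optimal_angles \<nu> \<phi> \<psi> r ?y \<gamma>" using assms(2,3) \<gamma> by (simp add: optimal_angles_iff)
    then show ?thesis using opt unfolding unique_optimal_angles_def by blast
  next
    case True
    have "(cos \<phi>)\<^sup>2 \<le> 1" "(cos ?y)\<^sup>2 \<le> 1" by (simp_all add: abs_square_le_1)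
    then have "(cos \<phi>)\<^sup>2 = 1"
      using True mult_left_le[of "(cos ?y)\<^sup>2" "(cos \<phi>)\<^sup>2"] by simp
    moreover from this have "(cos ?y)\<^sup>2 = 1" using True by simp
    moreover have "0 \<le> cos \<phi>" using assms(4,5) by (intro cos_ge_zero) auto
    ultimately have "cos \<phi> = 1" and y: "cos ?y = 1 \<or> cos ?y = - 1"
      unfolding power2_eq_1_iff by linarith+
    then have "\<phi> = 0" using assms(4,5) arccos_cos[of \<phi>] pi_ge_zero by simp
    then have "cos ?y = - 1"
      using y max_breach_payoff_not_at_defender[OF assms(1-3) \<gamma> _ max[unfolded \<open>\<phi> = 0\<close>]] by blast
    moreover have "\<bar>cos \<gamma>\<bar> \<le> \<nu>"
      by (rule max_breach_payoff_at_antipode[OF assms(1-3) \<gamma> calculation max[unfolded \<open>\<phi> = 0\<close>]])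
    ultimately show ?thesis
      using optimal_angle_at_antipode[OF assms(1-3) \<gamma>, of \<psi> \<theta> \<beta>] not_captured opt \<open>\<phi> = 0\<close>
      unfolding unique_optimal_angles_def by blast
  qed
  then show ?thesis using max[OF b] by simp
qed

section \<open>Motion towards a breaching point\<close>

definition breach_point :: "complex \<Rightarrow> real \<Rightarrow> complex" where
  "breach_point z \<beta> = z * cis (- \<beta>) / (of_real (cos \<beta>) - \<i> * of_real (sqrt ((cmod z)\<^sup>2 - (cos \<beta>)\<^sup>2)))"

text \<open>Written as \<open>z = b * cis \<beta> * (cos \<beta> - \<i> * w)\<close>, the factor \<open>b * cis \<beta>\<close> carries the direction of
  motion towards the breaching point \<open>b\<close> and only \<open>w\<close> changes along that motion.\<close>

lemma of_real_minus_i_of_real_nonzero: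
  fixes c w :: real
  assumes "0 < w"
  shows "of_real c - \<i> * of_real w \<noteq> (0 :: complex)"
  using assms by (simp add: complex_eq_iff)

lemma cmod_of_real_minus_i_of_real: "cmod (of_real c - \<i> * of_real w) = sqrt (c\<^sup>2 + w\<^sup>2)"
  by (simp add: cmod_def)

lemma norm_breach_point:
  assumes "1 < cmod z"
  shows "cmod (breach_point z \<beta>) = 1"
proof -
  have "z \<noteq> 0" using assms by auto
  then show ?thesis
    using square_minus_cos_square_pos(2)[OF assms, of \<beta>]
    by (simp add: breach_point_def norm_divide norm_mult cmod_of_real_minus_i_of_real)
qed

text \<open>The denominator in \<open>breach_point\<close> has modulus \<open>r\<close> and argument
  \<open>- arccos (cos \<beta> / r)\<close>. The Cartesian formula is what gets differentiated,
  since azimuths are fixed only modulo \<open>2 * pi\<close> and may jump.\<close>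

lemma breach_point_polar:
  assumes "1 < r"
  shows "breach_point (of_real r * cis a) \<beta> = cis (breach_angle r a \<beta>)"
proof -
  define w where "w = sqrt (r\<^sup>2 - (cos \<beta>)\<^sup>2)"
  have w: "0 < w" using square_minus_cos_square_pos(2)[OF assms] by (simp add: w_def)
  have norm: "cmod (of_real r * cis a) = r" using assms by (simp add: norm_mult)
  have "of_real (cos \<beta>) - \<i> * of_real w = of_real r * cis (- arccos (cos \<beta> / r))"
    using assms by (simp add: complex_eq_iff cos_arccos_cos_div sin_arccos_cos_div w_def)
  then have "breach_point (of_real r * cis a) \<beta> = cis a * cis (- \<beta>) / cis (- arccos (cos \<beta> / r))"
    using assms unfolding breach_point_def norm by (simp add: w_def)
  also have "\<dots> = cis (breach_angle r a \<beta>)"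
    unfolding cis_mult cis_divide breach_angle_def by simp
  finally show ?thesis .
qed

lemma inner_mult_left_complex:
  fixes p u v :: complex
  shows "(p * u) \<bullet> (p * v) = (cmod p)\<^sup>2 * (u \<bullet> v)"
  unfolding inner_complex_def cmod_power2 by (simp add: algebra_simps power2_eq_square)

text \<open>Here \<open>\<beta>\<close> is frozen. Moving along the line of sight keeps that line's
  distance \<open>\<bar>cos \<beta>\<bar>\<close> from the origin, so to first order the point
  reached at angle \<open>\<beta>\<close> stays put and only \<open>w\<close> shrinks, at rate
  \<open>\<nu>\<close>.\<close>

lemma breach_point_and_approach_length_derivatives:
  assumes "1 < cmod (Y t)"
    and Y: "(Y has_vector_derivative \<nu> *\<^sub>R sgn (breach_point (Y t) \<beta> - Y t)) (at t within S)"
  shows "((\<lambda>s. breach_point (Y s) \<beta>) has_vector_derivative 0) (at t within S)"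
    and "((\<lambda>s. approach_length (cmod (Y s)) \<beta>) has_real_derivative - \<nu>) (at t within S)"
proof -
  define w where "w s = sqrt ((cmod (Y s))\<^sup>2 - (cos \<beta>)\<^sup>2)" for s
  define q where "q s = of_real (cos \<beta>) - \<i> * of_real (w s)" for s
  define p where "p = breach_point (Y t) \<beta> * cis \<beta>"
  have pos: "0 < (cmod (Y t))\<^sup>2 - (cos \<beta>)\<^sup>2"
    by (rule square_minus_cos_square_pos(2)[OF assms(1)])
  then have w: "0 < w t" by (simp add: w_def)
  have sw: "sin \<beta> < w t" unfolding w_def by (rule sin_less_sqrt[OF assms(1)])
  have q: "q t \<noteq> 0" unfolding q_def by (rule of_real_minus_i_of_real_nonzero[OF w])
  have p: "cmod p = 1" by (simp add: p_def norm_mult norm_breach_point[OF assms(1)])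
  have cc: "cis (- \<beta>) * cis \<beta> = 1" by (simp add: cis_mult)
  have b: "breach_point (Y s) \<beta> = Y s * cis (- \<beta>) / q s" for s
    by (simp add: breach_point_def q_def w_def)
  have Yt: "Y t = p * q t" using q cc by (simp add: p_def b mult.assoc)
  have "breach_point (Y t) \<beta> - Y t = p * cis (- \<beta>) - p * q t"
    using cc Yt by (simp add: p_def mult.assoc mult.commute)
  also have "\<dots> = (w t - sin \<beta>) *\<^sub>R (p * \<i>)"
    unfolding q_def right_diff_distrib[symmetric] by (simp add: complex_eq_iff algebra_simps)
  finally have "sgn (breach_point (Y t) \<beta> - Y t) = p * \<i>"
    using sw p by (simp add: sgn_scaleR) (simp add: sgn_div_norm norm_mult)
  then have Y': "(Y has_vector_derivative \<nu> *\<^sub>R (p * \<i>)) (at t within S)" using Y by simp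
  have "((\<lambda>s. Y s \<bullet> Y s - (cos \<beta>)\<^sup>2) has_real_derivative - 2 * \<nu> * w t) (at t within S)"
  proof -
    have "((\<lambda>s. Y s \<bullet> Y s - (cos \<beta>)\<^sup>2) has_derivative
        (\<lambda>h. Y t \<bullet> (h *\<^sub>R (\<nu> *\<^sub>R (p * \<i>))) + (h *\<^sub>R (\<nu> *\<^sub>R (p * \<i>))) \<bullet> Y t - 0)) (at t within S)"
      using Y' unfolding has_vector_derivative_def by (intro derivative_intros)
    moreover have "Y t \<bullet> (p * \<i>) = - w t"
      unfolding Yt inner_mult_left_complex by (simp add: p q_def inner_complex_def)
    then have "(\<lambda>h. Y t \<bullet> (h *\<^sub>R (\<nu> *\<^sub>R (p * \<i>))) + (h *\<^sub>R (\<nu> *\<^sub>R (p * \<i>))) \<bullet> Y t - 0)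
        = (*) (- 2 * \<nu> * w t)"
      by (simp add: fun_eq_iff inner_commute)
    ultimately show ?thesis by (simp only: has_field_derivative_def)
  qed
  moreover have "0 < Y t \<bullet> Y t - (cos \<beta>)\<^sup>2" using pos by (simp only: power2_norm_eq_inner)
  ultimately have "((\<lambda>s. sqrt (Y s \<bullet> Y s - (cos \<beta>)\<^sup>2)) has_real_derivative
      inverse (sqrt (Y t \<bullet> Y t - (cos \<beta>)\<^sup>2)) / 2 * (- 2 * \<nu> * w t)) (at t within S)"
    by (intro DERIV_chain2[OF DERIV_real_sqrt])
  then have w': "(w has_real_derivative - \<nu>) (at t within S)"
    using w unfolding power2_norm_eq_inner[symmetric] w_def[symmetric] by (simp add: field_simps)
  then show "((\<lambda>s. approach_length (cmod (Y s)) \<beta>) has_real_derivative - \<nu>) (at t within S)"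
    unfolding approach_length_def w_def[symmetric] by (auto intro!: derivative_eq_intros)
  have "(w has_derivative (\<lambda>h. - \<nu> * h)) (at t within S)"
    using w' by (simp only: has_field_derivative_def)
  then have "(q has_derivative (\<lambda>h. 0 - \<i> * of_real (- \<nu> * h))) (at t within S)"
    unfolding q_def[abs_def] by (intro derivative_intros)
  moreover have "((\<lambda>s. Y s * cis (- \<beta>)) has_derivative (\<lambda>h. h *\<^sub>R (\<nu> *\<^sub>R (p * \<i>)) * cis (- \<beta>))) (at t within S)"
    using Y' unfolding has_vector_derivative_def by (intro derivative_intros)
  ultimately have "((\<lambda>s. breach_point (Y s) \<beta>) has_derivative
      (\<lambda>h. (h *\<^sub>R (\<nu> *\<^sub>R (p * \<i>)) * cis (- \<beta>) * q t - Y t * cis (- \<beta>) * (0 - \<i> * of_real (- \<nu> * h)))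
        / (q t * q t))) (at t within S)"
    unfolding b using q by (intro has_derivative_divide') auto
  \<comment> \<open>By \<open>Y t = p * q t\<close> the two terms in the numerator of the quotient
    rule coincide.\<close>
  moreover have "h *\<^sub>R (\<nu> *\<^sub>R (p * \<i>)) * cis (- \<beta>) * q t - Y t * cis (- \<beta>) * (0 - \<i> * of_real (- \<nu> * h)) = 0" for h
    unfolding Yt by (simp add: scaleR_conv_of_real)
  ultimately show "((\<lambda>s. breach_point (Y s) \<beta>) has_vector_derivative 0) (at t within S)"
    by (simp add: has_vector_derivative_def)
qed

section \<open>The payoff in Cartesian coordinates\<close>

definition ground :: "complex \<Rightarrow> real^3" where
  "ground z = vector [Re z, Im z, 0]"

lemma ground_cis: "ground (of_real r * cis a) = sph_point a 0 r"
  by (simp add: ground_def sph_point_def)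

lemma inner_ground [simp]: "ground u \<bullet> ground v = u \<bullet> v"
  by (simp add: ground_def inner_vec_def sum_3 inner_complex_def)

lemma norm_ground [simp]: "norm (ground z) = cmod z"
  by (simp add: norm_eq_sqrt_inner)

lemma bounded_linear_ground: "bounded_linear ground"
proof (rule bounded_linear_intro[where K = 1])
  show "ground (x + y) = ground x + ground y" for x y
    by (simp add: ground_def vec_eq_iff forall_3)
  show "ground (r *\<^sub>R x) = r *\<^sub>R ground x" for r x
    by (simp add: ground_def vec_eq_iff forall_3)
qed simp

lemma dist_ground [simp]: "dist (ground u) (ground v) = dist u v"
  by (simp add: dist_norm flip: bounded_linear.linear[OF bounded_linear_ground, THEN linear_diff])

definition planar_payoff :: "real \<Rightarrow> real^3 \<Rightarrow> complex \<Rightarrow> real \<Rightarrow> real" where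
  "planar_payoff \<nu> x z \<beta> = arccos (x \<bullet> ground (breach_point z \<beta>)) - approach_length (cmod z) \<beta> / \<nu>"

lemma planar_payoff_polar:
  assumes "1 < r"
  shows "planar_payoff \<nu> (sph_point d \<phi> 1) (of_real r * cis a) \<beta> = breach_payoff \<nu> \<phi> (a - d) r \<beta>"
proof -
  have "breach_angle r (a - d) \<beta> = breach_angle r a \<beta> - d" by (simp add: breach_angle_def)
  moreover have "sph_point d \<phi> 1 \<bullet> ground (cis x) = cos \<phi> * cos (x - d)" for x
    by (simp add: sph_point_def ground_def inner_vec_def sum_3 cos_diff algebra_simps)
  moreover have "cmod (of_real r * cis a) = r" using assms by (simp add: norm_mult)
  ultimately show ?thesis
    unfolding planar_payoff_def breach_payoff_def breach_point_polar[OF assms] by simp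
qed

text \<open>The parameter space is arbitrary so that \<open>S\<close> can be a rectangle of times
  and approach angles, which gives joint continuity.\<close>

lemma continuous_on_planar_payoff:
  fixes x :: "'a :: t2_space \<Rightarrow> real^3"
  assumes "0 < \<nu>" "continuous_on S x" "continuous_on S z" "continuous_on S b"
    and x: "\<And>s. s \<in> S \<Longrightarrow> norm (x s) = 1" and z: "\<And>s. s \<in> S \<Longrightarrow> 1 < cmod (z s)"
  shows "continuous_on S (\<lambda>s. planar_payoff \<nu> (x s) (z s) (b s))"
proof -
  have "of_real (cos (b s)) - \<i> * of_real (sqrt ((cmod (z s))\<^sup>2 - (cos (b s))\<^sup>2)) \<noteq> 0" if "s \<in> S" for s
    using square_minus_cos_square_pos(2)[OF z[OF that], of "b s"]
    by (intro of_real_minus_i_of_real_nonzero) simp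
  moreover have "continuous_on S (\<lambda>s. cis (- b s))"
    using assms(4) unfolding cis.ctr by (intro continuous_intros)
  ultimately have "continuous_on S (\<lambda>s. breach_point (z s) (b s))"
    unfolding breach_point_def using assms by (intro continuous_intros) auto
  then have "continuous_on S (\<lambda>s. ground (breach_point (z s) (b s)))"
    by (rule bounded_linear.continuous_on[OF bounded_linear_ground])
  moreover have "- 1 \<le> x s \<bullet> ground (breach_point (z s) (b s)) \<and>
      x s \<bullet> ground (breach_point (z s) (b s)) \<le> 1" if "s \<in> S" for s
    using Cauchy_Schwarz_ineq2[of "x s" "ground (breach_point (z s) (b s))"]
      x[OF that] norm_breach_point[OF z[OF that]] by (simp add: abs_le_iff)
  ultimately show ?thesis
    unfolding planar_payoff_def approach_length_def using assms by (intro continuous_intros) auto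
qed

text \<open>At fixed \<open>\<beta>\<close> two unit rates compensate: by the spherical triangle
  inequality the defender lowers its distance at rate at most 1, while the intruder's remaining
  travel time falls at rate exactly 1.\<close>

lemma planar_payoff_right_dini_nonneg:
  assumes "0 < \<nu>" "t \<in> S" "1-lipschitz_on S x"
    and x: "\<And>s. s \<in> S \<Longrightarrow> norm (x s) = 1" and outside: "\<And>s. s \<in> S \<Longrightarrow> 1 < cmod (Y s)"
    and Y: "(Y has_vector_derivative \<nu> *\<^sub>R sgn (breach_point (Y t) \<beta> - Y t)) (at t within S)"
    and "0 < e"
  obtains d where "0 < d" "\<And>s. s \<in> S \<Longrightarrow> t < s \<Longrightarrow> s < t + d \<Longrightarrow>
    planar_payoff \<nu> (x t) (Y t) \<beta> - e * (s - t) \<le> planar_payoff \<nu> (x s) (Y s) \<beta>"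
proof -
  let ?b = "\<lambda>s. breach_point (Y s) \<beta>"
  let ?L = "\<lambda>s. approach_length (cmod (Y s)) \<beta>"
  \<comment> \<open>Four errors of size \<open>\<epsilon> * h\<close> arise: one from arc against
    chord for the defender, two from the drift of the breaching point, one from the travel time. The
    cap 1 gives \<open>1 + \<epsilon> \<le> 2\<close> and keeps the drift below
    \<open>d1\<close>.\<close>
  define \<epsilon> where "\<epsilon> = min 1 (e / 4)"
  have \<epsilon>: "0 < \<epsilon>" "\<epsilon> \<le> 1" "4 * \<epsilon> \<le> e" using assms(7) by (auto simp: \<epsilon>_def)
  obtain d1 where d1: "0 < d1" "\<And>u v :: real^3. norm u = 1 \<Longrightarrow> norm v = 1 \<Longrightarrow> dist u v < d1 \<Longrightarrow>
       arccos (u \<bullet> v) \<le> (1 + \<epsilon>) * dist u v"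
    using arccos_inner_le_dist[OF \<epsilon>(1), where 'a = "real^3"] by blast
  note der = breach_point_and_approach_length_derivatives[OF outside[OF assms(2)] Y]
  obtain d2 where d2: "0 < d2" "\<And>s. s \<in> S \<Longrightarrow> norm (s - t) < d2 \<Longrightarrow>
      norm (?b s - ?b t - (s - t) *\<^sub>R 0) \<le> \<epsilon> * norm (s - t)"
    using der(1) \<epsilon>(1) unfolding has_vector_derivative_def has_derivative_within_alt by blast
  obtain d3 where d3: "0 < d3" "\<And>s. s \<in> S \<Longrightarrow> norm (s - t) < d3 \<Longrightarrow>
      norm (?L s - ?L t - - \<nu> * (s - t)) \<le> \<nu> * \<epsilon> * norm (s - t)"
    using der(2) \<epsilon>(1) assms(1) unfolding has_field_derivative_def has_derivative_within_alt
    by (meson mult_pos_pos)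
  show ?thesis
  proof (rule that)
    show "0 < min d1 (min d2 d3)" using d1(1) d2(1) d3(1) by simp
    fix s assume s: "s \<in> S" "t < s" "s < t + min d1 (min d2 d3)"
    define h where "h = s - t"
    have h: "0 < h" "h < d1" "h < d2" "h < d3" "norm (s - t) = h" using s by (auto simp: h_def)
    note nb = norm_breach_point[OF outside[OF s(1)], of \<beta>] norm_breach_point[OF outside[OF assms(2)], of \<beta>]
    have "dist (x t) (x s) \<le> h"
      using lipschitz_onD[OF assms(3,2) s(1)] h by (simp add: dist_real_def h_def)
    then have "arccos (x t \<bullet> x s) \<le> (1 + \<epsilon>) * dist (x t) (x s)"
      using h by (intro d1(2) x assms(2) s(1)) auto
    also have "\<dots> \<le> (1 + \<epsilon>) * h" using \<open>dist (x t) (x s) \<le> h\<close> \<epsilon> by (intro mult_left_mono) auto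
    finally have ax: "arccos (x t \<bullet> x s) \<le> (1 + \<epsilon>) * h" .
    have db: "dist (ground (?b s)) (ground (?b t)) \<le> \<epsilon> * h"
      unfolding dist_ground using d2(2)[OF s(1)] h by (simp add: dist_norm)
    moreover have "\<epsilon> * h \<le> h" using \<epsilon> h by simp
    ultimately have "arccos (ground (?b s) \<bullet> ground (?b t)) \<le> (1 + \<epsilon>) * dist (ground (?b s)) (ground (?b t))"
      using h by (intro d1(2)) (simp_all only: norm_ground nb)
    also have "\<dots> \<le> 2 * (\<epsilon> * h)" using db \<epsilon> h by (intro mult_mono) auto
    finally have ab: "arccos (ground (?b s) \<bullet> ground (?b t)) \<le> 2 * (\<epsilon> * h)" .
    have "arccos (x t \<bullet> ground (?b t)) \<le> arccos (x t \<bullet> x s) + arccos (x s \<bullet> ground (?b t))"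
      by (intro arccos_inner_triangle x assms(2) s(1)) (simp only: norm_ground nb)
    also have "arccos (x s \<bullet> ground (?b t))
        \<le> arccos (x s \<bullet> ground (?b s)) + arccos (ground (?b s) \<bullet> ground (?b t))"
      by (intro arccos_inner_triangle x s(1)) (simp_all only: norm_ground nb)
    finally have angle: "arccos (x t \<bullet> ground (?b t)) \<le> arccos (x s \<bullet> ground (?b s)) + (1 + \<epsilon>) * h + 2 * (\<epsilon> * h)"
      using ax ab by linarith
    have "?L s - ?L t + \<nu> * h \<le> \<nu> * \<epsilon> * h"
      using d3(2)[OF s(1)] h by (simp add: h_def)
    then have "(?L s - ?L t + \<nu> * h) / \<nu> \<le> (\<nu> * \<epsilon> * h) / \<nu>" using assms(1) by (intro divide_right_mono) auto
    then have "?L s / \<nu> \<le> ?L t / \<nu> - h + \<epsilon> * h"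
      using assms(1) by (simp add: add_divide_distrib diff_divide_distrib)
    then have "planar_payoff \<nu> (x t) (Y t) \<beta> - 4 * \<epsilon> * h \<le> planar_payoff \<nu> (x s) (Y s) \<beta>"
      using angle by (simp add: planar_payoff_def algebra_simps)
    moreover have "4 * \<epsilon> * h \<le> e * h" using \<epsilon>(3) h(1) by (intro mult_right_mono) auto
    ultimately show "planar_payoff \<nu> (x t) (Y t) \<beta> - e * (s - t) \<le> planar_payoff \<nu> (x s) (Y s) \<beta>"
      by (simp add: h_def)
  qed
qed

section \<open>Monotonicity of the payoff along the play\<close>

lemma norm_sph_point: "norm (sph_point a el 1) = 1"
proof -
  have "(cos el * cos a) * (cos el * cos a) + (cos el * sin a) * (cos el * sin a) + sin el * sin el = 1"
    using sin_cos_squared_add[of a] sin_cos_squared_add[of el] by algebra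
  then show ?thesis
    by (simp only: sph_point_def norm_eq_sqrt_inner inner_vec_def sum_3 vector_3 inner_real_def
        mult_1 real_sqrt_one)
qed

theorem lemma12:
  fixes \<nu> T :: real
    and \<psi>D \<phi>D \<psi>A r \<theta> \<beta> :: "real \<Rightarrow> real"
    and zD zA zB :: "real \<Rightarrow> real^3"
  assumes speed_ratio: "0 < \<nu>" "\<nu> \<le> 1"
    and zD: "\<And>t. t \<in> {0..<T} \<Longrightarrow> zD t = sph_point (\<psi>D t) (\<phi>D t) 1"
    and elevation: "\<And>t. t \<in> {0..<T} \<Longrightarrow> 0 \<le> \<phi>D t \<and> \<phi>D t \<le> pi / 2"
    and zA: "\<And>t. t \<in> {0..<T} \<Longrightarrow> zA t = sph_point (\<psi>A t) 0 (r t)"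
    and outside: "\<And>t. t \<in> {0..<T} \<Longrightarrow> r t > 1"
    and not_captured:
      "\<And>t. t \<in> {0..<T} \<Longrightarrow> \<not> (\<phi>D t = 0 \<and> [\<psi>A t - \<psi>D t = 0] (rmod (2 * pi)))"
    and optimal:
      "\<And>t. t \<in> {0..<T} \<Longrightarrow>
         unique_optimal_angles \<nu> (\<phi>D t) (\<psi>A t - \<psi>D t) (r t) (\<theta> t) (\<beta> t)"
    and zB: "\<And>t. t \<in> {0..<T} \<Longrightarrow> zB t = sph_point (\<psi>D t + \<theta> t) 0 1"
    and defender_motion: "1-lipschitz_on {0..<T} zD"
    and intruder_motion:
      "\<And>t. t \<in> {0..<T} \<Longrightarrow>
         (zA has_vector_derivative \<nu> *\<^sub>R sgn (zB t - zA t)) (at t within {0..<T})"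
  shows "mono_on {0..<T} (\<lambda>t. payoff \<nu> (\<phi>D t) (\<psi>A t - \<psi>D t) (r t) (\<theta> t))"
proof -
  define Y where "Y t = Complex (zA t $ 1) (zA t $ 2)" for t
  define F where "F t b = planar_payoff \<nu> (zD t) (Y t) b" for t b
  define V where "V t = F t (\<beta> t)" for t
  let ?S = "{0..<T}"
  have Y: "Y t = of_real (r t) * cis (\<psi>A t)" if "t \<in> ?S" for t
    using zA[OF that] by (simp add: Y_def sph_point_def complex_eq_iff)
  have normY: "1 < cmod (Y t)" if "t \<in> ?S" for t
    using outside[OF that] by (simp add: Y[OF that] norm_mult)
  have normD: "norm (zD t) = 1" if "t \<in> ?S" for t
    by (simp add: zD[OF that] norm_sph_point)
  have opt: "\<beta> t \<in> {0..pi}" "[\<theta> t = breach_angle (r t) (\<psi>A t - \<psi>D t) (\<beta> t)] (rmod 2 * pi)"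
    if "t \<in> ?S" for t
    using optimal[OF that] speed_ratio by (auto simp: unique_optimal_angles_def optimal_angles_iff)
  have F: "F t b = breach_payoff \<nu> (\<phi>D t) (\<psi>A t - \<psi>D t) (r t) b" if "t \<in> ?S" for t b
    unfolding F_def zD[OF that] Y[OF that] by (rule planar_payoff_polar[OF outside[OF that]])
  have V: "payoff \<nu> (\<phi>D t) (\<psi>A t - \<psi>D t) (r t) (\<theta> t) = V t" if "t \<in> ?S" for t
    unfolding V_def F[OF that] by (rule payoff_eq_breach_payoff[OF outside[OF that] opt(2)[OF that]])
  \<comment> \<open>From here on optimality enters only through this maximality of
    \<open>\<beta> t\<close>.\<close>
  have max: "F t b \<le> V t" if "t \<in> ?S" "b \<in> {0..pi}" for t b
    unfolding V_def F[OF that(1)] using that elevation[OF that(1)]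
    by (intro unique_optimal_angle_is_max[where \<theta> = "\<theta> t"] outside speed_ratio not_captured optimal) auto
  have derY: "(Y has_vector_derivative \<nu> *\<^sub>R sgn (breach_point (Y t) (\<beta> t) - Y t)) (at t within ?S)"
    if t: "t \<in> ?S" for t
  proof -
    \<comment> \<open>Adding the defender's azimuth turns the relative breaching angle into the
      absolute one, so that the intruder's target becomes
      \<open>breach_point (Y t) (\<beta> t)\<close>.\<close>
    have "[\<psi>D t + \<theta> t = \<psi>D t + breach_angle (r t) (\<psi>A t - \<psi>D t) (\<beta> t)] (rmod 2 * pi)"
      using opt(2)[OF t] by simp
    also have "\<psi>D t + breach_angle (r t) (\<psi>A t - \<psi>D t) (\<beta> t) = breach_angle (r t) (\<psi>A t) (\<beta> t)"
      by (simp add: breach_angle_def)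
    finally have "cis (\<psi>D t + \<theta> t) = breach_point (Y t) (\<beta> t)"
      unfolding Y[OF t] breach_point_polar[OF outside[OF t]]
      by (simp add: complex_eq_iff cos_sin_rcong)
    then have "zB t = ground (breach_point (Y t) (\<beta> t))"
      using ground_cis[of 1 "\<psi>D t + \<theta> t"] by (simp add: zB[OF t])
    moreover have "zA t = ground (Y t)"
      by (simp only: zA[OF t] Y[OF t] ground_cis)
    ultimately have "zB t - zA t = ground (breach_point (Y t) (\<beta> t) - Y t)"
      by (simp only: linear_diff[OF bounded_linear.linear[OF bounded_linear_ground]])
    then have sgn: "sgn (zB t - zA t) = ground (sgn (breach_point (Y t) (\<beta> t) - Y t))"
      by (simp add: sgn_div_norm linear_scale[OF bounded_linear.linear[OF bounded_linear_ground]])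
    have coord: "((\<lambda>t. zA t $ i) has_vector_derivative (\<nu> *\<^sub>R sgn (zB t - zA t)) $ i) (at t within ?S)" for i
      by (rule bounded_linear.has_vector_derivative[OF bounded_linear_vec_nth intruder_motion[OF t]])
    show ?thesis
      using coord[of 1] coord[of 2] unfolding has_vector_derivative_complex_iff sgn
      by (simp add: Y_def ground_def has_real_derivative_iff_has_vector_derivative)
  qed
  have contY: "continuous_on ?S Y"
    unfolding continuous_on_eq_continuous_within
    using derY has_vector_derivative_continuous by blast
  have contD: "continuous_on ?S zD" by (rule lipschitz_on_continuous_on[OF defender_motion])
  \<comment> \<open>The comparison is made at the earlier angle \<open>\<beta> s\<close>, which may
    behave arbitrarily as \<open>s\<close> tends to \<open>t\<close>; uniform continuity on a
    compact rectangle makes the estimate independent of it.\<close>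
  have left: "\<forall>\<^sub>F s in at_left t. V s \<le> V t + e" if t: "t \<in> ?S" "0 < t" and "0 < e" for t e
  proof -
    let ?R = "{0..t} \<times> {0..pi}"
    have sub: "{0..t} \<subseteq> ?S" using t by auto
    have "continuous_on ?R (\<lambda>(s, b). F s b)"
      unfolding F_def case_prod_unfold using sub
      by (intro continuous_on_planar_payoff speed_ratio normD normY continuous_intros
          continuous_on_compose2[OF contD] continuous_on_compose2[OF contY]) auto
    then have "uniformly_continuous_on ?R (\<lambda>(s, b). F s b)"
      by (intro compact_uniformly_continuous compact_Times compact_Icc)
    then obtain d where d: "0 < d" "\<And>p q. p \<in> ?R \<Longrightarrow> q \<in> ?R \<Longrightarrow> dist q p < d \<Longrightarrow>
        dist (case q of (s, b) \<Rightarrow> F s b) (case p of (s, b) \<Rightarrow> F s b) < e"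
      using \<open>0 < e\<close> unfolding uniformly_continuous_on_def by blast
    have "V s \<le> V t + e" if s: "max 0 (t - d) < s" "s < t" for s
    proof -
      have "s \<in> ?S" "\<beta> s \<in> {0..pi}" using s t opt(1)[of s] by auto
      then have "\<bar>F s (\<beta> s) - F t (\<beta> s)\<bar> < e"
        using d(2)[of "(t, \<beta> s)" "(s, \<beta> s)"] s t by (simp add: dist_real_def dist_Pair_Pair)
      then show ?thesis using max[OF t(1) \<open>\<beta> s \<in> {0..pi}\<close>] by (simp add: V_def)
    qed
    then show ?thesis
      using t d(1) unfolding eventually_at_left[OF t(2)]
      by (intro bexI[of _ "max 0 (t - d)"] exI[of _ "max 0 (t - d)"]) auto
  qed
  \<comment> \<open>Here the angle \<open>\<beta> t\<close> is kept: it is merely a competitor at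
    the later time \<open>s\<close>, where \<open>V s\<close> can only be larger.\<close>
  have right: "\<forall>\<^sub>F s in at_right t. V t - e * (s - t) \<le> V s" if t: "t \<in> ?S" and "0 < e" for t e
  proof -
    obtain d where d: "0 < d" "\<And>s. s \<in> ?S \<Longrightarrow> t < s \<Longrightarrow> s < t + d \<Longrightarrow>
        F t (\<beta> t) - e * (s - t) \<le> F s (\<beta> t)"
      unfolding F_def using planar_payoff_right_dini_nonneg[OF speed_ratio(1) t defender_motion
        normD normY derY[OF t] \<open>0 < e\<close>] by blast
    have "V t - e * (s - t) \<le> V s" if s: "t < s" "s < min T (t + d)" for s
    proof -
      have "s \<in> ?S" using s t by auto
      then show ?thesis using d(2)[of s] s max[of s "\<beta> t"] opt(1)[OF t] by (simp add: V_def)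
    qed
    moreover have "t < min T (t + d)" using t d(1) by simp
    ultimately show ?thesis using eventually_at_right[of t "min T (t + d)"] by blast
  qed
  show ?thesis
  proof (rule mono_onI)
    fix a b assume ab: "a \<in> ?S" "b \<in> ?S" "a \<le> b"
    have "V a \<le> V b" by (rule le_if_right_dini_nonneg[OF ab(3)]) (use ab in \<open>auto intro!: left right\<close>)
    then show "payoff \<nu> (\<phi>D a) (\<psi>A a - \<psi>D a) (r a) (\<theta> a)
        \<le> payoff \<nu> (\<phi>D b) (\<psi>A b - \<psi>D b) (r b) (\<theta> b)"
      using ab by (simp only: V)
  qed
qed

end
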